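(* There exists a universal constant $C\in(0,\infty)$ such that the following holds. Let $k,m,n\in\mathbb{N}$ and let $A:\mathbb{R}^m\to\mathbb{R}^n$ be a linear operator satisfying $\mathrm{rank}(A)>k$. Let $\omega\subseteq\{1,\ldots,m\}$ be any subset with $|\omega|=\mathrm{rank}(A)$ such that the vectors $\{Ae_i\}_{i\in\omega}\subseteq\mathbb{R}^n$ are linearly independent. For every $j\in\omega$ let $$F_j=\left(\mathrm{span}\{Ae_i\}_{i\in\omega\setminus\{j\}}\right)^\perp\subseteq\mathbb{R}^n.$$ Then there exists a subset $\sigma\subseteq\omega$ with $|\sigma|=k$ such that $$\|(AJ_\sigma)^{-1}\|_{S_\infty}\le C\,\frac{\sqrt{\mathrm{rank}(A)}}{\sqrt{\mathrm{rank}(A)-k}}\cdot\max_{j\in\omega}\frac{1}{\|\mathrm{Proj}_{F_j}Ae_j\|_2}.$$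
   Context: $\mathbb{N}=\{1,2,\ldots\}$; $e_1,\ldots,e_m$ is the standard basis of $\mathbb{R}^m$; $\|\cdot\|_2$ is the Euclidean norm and $\perp$ denotes orthogonal complement in $\mathbb{R}^n$ (with the span of the empty set equal to $\{0\}$). For a linear subspace $F\subseteq\mathbb{R}^n$, $\mathrm{Proj}_F$ is the orthogonal projection of $\mathbb{R}^n$ onto $F$. $\|\cdot\|_{S_\infty}$ is the operator norm with respect to Euclidean norms. For $\sigma\subseteq\{1,\ldots,m\}$, $J_\sigma:\mathbb{R}^\sigma\to\mathbb{R}^m$ is the inclusion $J_\sigma((a_j)_{j\in\sigma})=\sum_{j\in\sigma}a_je_j$. If $AJ_\sigma$ is injective, $(AJ_\sigma)^{-1}:A(\mathbb{R}^\sigma)\to\mathbb{R}^\sigma$ denotes the inverse of $AJ_\sigma$ defined on its image; if $AJ_\sigma$ is not injective, one sets $\|(AJ_\sigma)^{-1}\|_{S_\infty}=\infty$. *)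

theory Defs
  imports
    "HOL-Analysis.L2_Norm"
    "HOL-Library.Extended_Real"
    "Jordan_Normal_Form.DL_Rank"
begin

(* The universal constant must not depend on the dimensions, so these are quantified inside
   the formula and cannot be types: R^n is carrier_vec n and a linear operator from R^m to R^n
   is a matrix in carrier_mat n m.  Coordinates are indexed by {0..<m} instead of {1..m}, so
   col A j is the image of the j-th standard basis vector. *)

abbreviation real_rank :: "nat \<Rightarrow> real mat \<Rightarrow> nat"
  where "real_rank n \<equiv> vec_space.rank n"

abbreviation real_span :: "nat \<Rightarrow> real vec set \<Rightarrow> real vec set"
  where "real_span n \<equiv> LinearCombinations.module.span class_ring (module_vec TYPE(real) n)"

(* Linear independence of an indexed family; the library notion is about sets, hence the
   injectivity requirement. *)
definition lin_indpt_family :: "nat \<Rightarrow> ('i \<Rightarrow> real vec) \<Rightarrow> 'i set \<Rightarrow> bool"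
  where "lin_indpt_family n v I \<longleftrightarrow> inj_on v I \<and>
    \<not> LinearCombinations.module.lin_dep class_ring (module_vec TYPE(real) n) (v ` I)"

definition vec_norm2 :: "real vec \<Rightarrow> real"
  where "vec_norm2 x = L2_set (vec_index x) {0..<dim_vec x}"

abbreviation orth_compl :: "nat \<Rightarrow> real vec set \<Rightarrow> real vec set"
  where "orth_compl n \<equiv> vec_module.orthogonal_complement n"

(* Intended for x in carrier_vec n and F a linear subspace of carrier_vec n. *)
definition orth_proj :: "nat \<Rightarrow> real vec set \<Rightarrow> real vec \<Rightarrow> real vec"
  where "orth_proj n F x = (THE y. y \<in> F \<and> x - y \<in> orth_compl n F)"

(* The space R^s for an index set s: functions on s, with value undefined outside s so that
   they are determined by their coordinates in s.  Its Euclidean norm is (\<lambda>a. L2_set a s). *)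
abbreviation coord_space :: "nat set \<Rightarrow> (nat \<Rightarrow> real) set"
  where "coord_space s \<equiv> PiE s (\<lambda>_. UNIV)"

definition coord_incl :: "nat \<Rightarrow> nat set \<Rightarrow> (nat \<Rightarrow> real) \<Rightarrow> real vec"
  where "coord_incl m s a = vec m (\<lambda>i. if i \<in> s then a i else 0)"

definition op_norm :: "'a set \<Rightarrow> ('a \<Rightarrow> real) \<Rightarrow> ('b \<Rightarrow> real) \<Rightarrow> ('a \<Rightarrow> 'b) \<Rightarrow> ereal"
  where "op_norm X normX normY T = (SUP x\<in>{x \<in> X. normX x \<le> 1}. ereal (normY (T x)))"

definition restr_op :: "real mat \<Rightarrow> nat set \<Rightarrow> (nat \<Rightarrow> real) \<Rightarrow> real vec"
  where "restr_op A s a = A *\<^sub>v coord_incl (dim_col A) s a"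

definition restr_inv_norm :: "real mat \<Rightarrow> nat set \<Rightarrow> ereal"
  where "restr_inv_norm A s =
    (if inj_on (restr_op A s) (coord_space s)
     then op_norm (restr_op A s ` coord_space s) vec_norm2 (\<lambda>a. L2_set a s)
            (inv_into (coord_space s) (restr_op A s))
     else \<infinity>)"

definition compl_space :: "nat \<Rightarrow> real mat \<Rightarrow> nat set \<Rightarrow> nat \<Rightarrow> real vec set"
  where "compl_space n A w j = orth_compl n (real_span n (col A ` (w - {j})))"

end

theory Submission
  imports Defs
begin

text \<open>Let \<open>G\<close> be the Gram matrix of the vectors \<open>A e\<^sub>i\<close>, \<open>i \<in> \<omega>\<close>, and \<open>D\<close> the maximum on the
  right-hand side.  The diagonal of the inverse of \<open>G\<close> consists of the squares of the numbers
  \<open>1 / \<parallel>Proj A e\<^sub>j\<parallel>\<close>, so its trace is at most \<open>T = rank(A) D\<^sup>2\<close>.  A barrier argument keeps the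
  trace of the inverse of \<open>G - b I\<close> (restricted to the current index set) below \<open>T\<close>:  raising \<open>b\<close>
  by \<open>\<delta> = 1 / (2 T)\<close> keeps the matrix positive definite, and if \<open>M\<close> is the new inverse, the trace
  grows by at most \<open>\<delta> tr M\<^sup>2\<close>, while deleting a suitable index \<open>j\<close> lowers it by
  \<open>(M\<^sup>2)\<^sub>j\<^sub>j / M\<^sub>j\<^sub>j \<ge> tr M\<^sup>2 / tr M \<ge> \<delta> tr M\<^sup>2\<close>.  After \<open>rank(A) - k\<close> deletions the Gram matrix of the
  remaining \<open>k\<close> vectors is at least \<open>(rank(A) - k) / (2 T)\<close>, which gives \<open>C = \<surd>2\<close>.\<close>

section \<open>Quadratic forms and inverses of matrices indexed by a finite set\<close>

definition bform :: "'a set \<Rightarrow> ('a \<Rightarrow> 'a \<Rightarrow> real) \<Rightarrow> ('a \<Rightarrow> real) \<Rightarrow> ('a \<Rightarrow> real) \<Rightarrow> real"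
  where "bform s S x y = (\<Sum>i\<in>s. \<Sum>j\<in>s. x i * S i j * y j)"

definition pos_def_on :: "'a set \<Rightarrow> ('a \<Rightarrow> 'a \<Rightarrow> real) \<Rightarrow> bool"
  where "pos_def_on s S \<longleftrightarrow> (\<forall>i\<in>s. \<forall>j\<in>s. S i j = S j i) \<and>
    (\<forall>x. (\<exists>i\<in>s. x i \<noteq> 0) \<longrightarrow> bform s S x x > 0)"

text \<open>This is a right inverse of the principal submatrix of \<open>S\<close> on
  \<open>s\<close>; the entries of \<open>M\<close> outside \<open>s\<close> are arbitrary. Deleting
  an index only shrinks \<open>s\<close>, while \<open>S\<close> stays the same function.\<close>

definition inverse_on :: "'a set \<Rightarrow> ('a \<Rightarrow> 'a \<Rightarrow> real) \<Rightarrow> ('a \<Rightarrow> 'a \<Rightarrow> real) \<Rightarrow> bool"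
  where "inverse_on s S M \<longleftrightarrow>
    (\<forall>i\<in>s. \<forall>q\<in>s. (\<Sum>p\<in>s. S i p * M p q) = (if i = q then 1 else 0))"

definition shift :: "('a \<Rightarrow> 'a \<Rightarrow> real) \<Rightarrow> real \<Rightarrow> 'a \<Rightarrow> 'a \<Rightarrow> real"
  where "shift S c i j = S i j - (if i = j then c else 0)"

lemma bform_row: "bform s S x y = (\<Sum>i\<in>s. x i * (\<Sum>j\<in>s. S i j * y j))"
  unfolding bform_def by (simp add: sum_distrib_left mult.assoc)

lemma bform_diff_left: "bform s S (\<lambda>i. x i - y i) z = bform s S x z - bform s S y z"
  unfolding bform_row by (simp add: left_diff_distrib sum_subtractf)

lemma bform_diff_right: "bform s S z (\<lambda>i. x i - y i) = bform s S z x - bform s S z y"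
  unfolding bform_def by (simp add: right_diff_distrib sum_subtractf)

lemma bform_scale_left: "bform s S (\<lambda>i. c * x i) y = c * bform s S x y"
  unfolding bform_def by (simp add: sum_distrib_left mult.assoc)

lemma bform_scale_right: "bform s S x (\<lambda>i. c * y i) = c * bform s S x y"
  unfolding bform_def by (simp add: sum_distrib_left mult.left_commute mult.assoc)

lemma bform_commute:
  assumes "pos_def_on s S"
  shows "bform s S x y = bform s S y x"
proof -
  have "bform s S x y = (\<Sum>j\<in>s. \<Sum>i\<in>s. x i * S i j * y j)"
    unfolding bform_def by (rule sum.swap)
  also have "\<dots> = bform s S y x"
    using assms unfolding bform_def pos_def_on_def
    by (intro sum.cong refl) (simp add: mult_ac)
  finally show ?thesis .
qed

lemma bform_nonneg:
  assumes "pos_def_on s S"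
  shows "bform s S x x \<ge> 0"
proof (cases "\<exists>i\<in>s. x i \<noteq> 0")
  case True
  then show ?thesis using assms unfolding pos_def_on_def by (simp add: less_imp_le)
next
  case False
  then show ?thesis unfolding bform_def by simp
qed

lemma bform_Cauchy_Schwarz:
  assumes S: "pos_def_on s S"
  shows "(bform s S x y)\<^sup>2 \<le> bform s S x x * bform s S y y"
proof (cases "\<exists>i\<in>s. y i \<noteq> 0")
  case True
  then have pos: "bform s S y y > 0"
    using S unfolding pos_def_on_def by simp
  define t where "t = bform s S x y / bform s S y y"
  have "0 \<le> bform s S (\<lambda>i. x i - t * y i) (\<lambda>i. x i - t * y i)"
    by (rule bform_nonneg[OF S])
  also have "\<dots> = bform s S x x - 2 * t * bform s S x y + t * t * bform s S y y"
    by (simp add: bform_diff_left bform_diff_right bform_scale_left bform_scale_right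
        bform_commute[OF S, of y x] algebra_simps)
  also have "\<dots> = bform s S x x - (bform s S x y)\<^sup>2 / bform s S y y"
    using pos by (simp add: t_def power2_eq_square)
  finally show ?thesis
    using pos by (simp add: field_simps)
next
  case False
  then show ?thesis unfolding bform_def by simp
qed

lemma bform_shift:
  assumes "finite s"
  shows "bform s (shift S c) x y = bform s S x y - c * (\<Sum>i\<in>s. x i * y i)"
proof -
  have "(\<Sum>j\<in>s. shift S c i j * y j) = (\<Sum>j\<in>s. S i j * y j) - c * y i" if "i \<in> s" for i
  proof -
    have "(\<Sum>j\<in>s. shift S c i j * y j) = (\<Sum>j\<in>s. S i j * y j - (if i = j then c * y j else 0))"
      by (intro sum.cong refl) (simp add: shift_def left_diff_distrib)
    then show ?thesis using assms that by (simp add: sum_subtractf)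
  qed
  then have "bform s (shift S c) x y = (\<Sum>i\<in>s. x i * ((\<Sum>j\<in>s. S i j * y j) - c * y i))"
    unfolding bform_row by (intro sum.cong refl) simp
  also have "\<dots> = bform s S x y - c * (\<Sum>i\<in>s. x i * y i)"
    unfolding bform_row by (simp add: right_diff_distrib sum_subtractf sum_distrib_left mult_ac)
  finally show ?thesis .
qed

lemma shift_shift: "shift (shift S c) d = shift S (c + d)"
  by (intro ext) (simp add: shift_def)

text \<open>Column \<open>j\<close> of the inverse represents evaluation at \<open>j\<close> with
  respect to the form. Inverses enter the later estimates mostly through this identity.\<close>

lemma bform_inverse_on:
  assumes "finite s" "inverse_on s S M" "j \<in> s"
  shows "bform s S x (\<lambda>p. M p j) = x j"
proof -
  have "bform s S x (\<lambda>p. M p j) = (\<Sum>i\<in>s. x i * (if i = j then 1 else 0))"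
    using assms unfolding bform_row inverse_on_def by (intro sum.cong refl) simp
  also have "\<dots> = (\<Sum>i\<in>s. if i = j then x i else 0)"
    by (intro sum.cong refl) simp
  finally show ?thesis using assms by simp
qed

lemma pos_def_on_mono:
  assumes "pos_def_on s S" "t \<subseteq> s" "finite s"
  shows "pos_def_on t S"
  unfolding pos_def_on_def
proof (intro conjI allI impI)
  show "\<forall>i\<in>t. \<forall>j\<in>t. S i j = S j i"
    using assms unfolding pos_def_on_def by blast
next
  fix x :: "'a \<Rightarrow> real" assume "\<exists>i\<in>t. x i \<noteq> 0"
  define y where "y = (\<lambda>i. if i \<in> t then x i else 0)"
  have "\<exists>i\<in>s. y i \<noteq> 0" using \<open>\<exists>i\<in>t. x i \<noteq> 0\<close> assms unfolding y_def by auto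
  then have "0 < bform s S y y" using assms unfolding pos_def_on_def by blast
  also have "bform s S y y = (\<Sum>i\<in>s. \<Sum>j\<in>t. y i * S i j * y j)"
    unfolding bform_def using assms
    by (intro sum.cong refl sum.mono_neutral_right) (auto simp: y_def)
  also have "\<dots> = (\<Sum>i\<in>t. \<Sum>j\<in>t. y i * S i j * y j)"
    using assms by (intro sum.mono_neutral_right) (auto simp: y_def)
  also have "\<dots> = bform t S x x"
    unfolding bform_def by (intro sum.cong refl) (simp add: y_def)
  finally show "bform t S x x > 0" .
qed

text \<open>Both entries are the value of the symmetric form at columns \<open>p\<close> and
  \<open>q\<close> of \<open>M\<close>.\<close>

lemma inverse_on_commute:
  assumes "finite s" "pos_def_on s S" "inverse_on s S M" "p \<in> s" "q \<in> s"
  shows "M p q = M q p"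
  using bform_inverse_on[OF assms(1,3,4), of "\<lambda>i. M i q"]
    bform_inverse_on[OF assms(1,3,5), of "\<lambda>i. M i p"]
    bform_commute[OF assms(2)] by metis

text \<open>The diagonal entry is the form evaluated at column \<open>j\<close> of \<open>M\<close>,
  which cannot vanish on \<open>s\<close>.\<close>

lemma inverse_on_diag_pos:
  assumes "finite s" "pos_def_on s S" "inverse_on s S M" "j \<in> s"
  shows "M j j > 0"
proof -
  have "\<exists>i\<in>s. M i j \<noteq> 0"
  proof (rule ccontr)
    assume "\<not> (\<exists>i\<in>s. M i j \<noteq> 0)"
    then have "(\<Sum>p\<in>s. S j p * M p j) = 0" by simp
    then show False using assms(3,4) unfolding inverse_on_def by auto
  qed
  then have "bform s S (\<lambda>i. M i j) (\<lambda>i. M i j) > 0"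
    using assms(2) unfolding pos_def_on_def by simp
  then show ?thesis using bform_inverse_on[OF assms(1,3,4)] by simp
qed

text \<open>The rank-one correction makes row \<open>j\<close> vanish, so the sum over
  \<open>s - {j}\<close> extends to \<open>s\<close>. There it contributes a multiple of entry
  \<open>(i, j)\<close> of the product of \<open>S\<close> and \<open>M\<close>, which is zero for
  \<open>i\<close> other than \<open>j\<close>.\<close>

lemma inverse_on_delete:
  assumes fin: "finite s" and j: "j \<in> s" and inv: "inverse_on s S M" and nz: "M j j \<noteq> 0"
  shows "inverse_on (s - {j}) S (\<lambda>p q. M p q - M p j * M j q / M j j)"
  unfolding inverse_on_def
proof (intro ballI)
  fix i q assume i: "i \<in> s - {j}" and q: "q \<in> s - {j}"
  have "(\<Sum>p\<in>s - {j}. S i p * (M p q - M p j * M j q / M j j))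
      = (\<Sum>p\<in>s. S i p * (M p q - M p j * M j q / M j j))"
    using fin nz by (intro sum.mono_neutral_left) auto
  also have "\<dots> = (\<Sum>p\<in>s. S i p * M p q) - (\<Sum>p\<in>s. S i p * M p j) * (M j q / M j j)"
    by (simp add: right_diff_distrib sum_subtractf sum_distrib_right sum_divide_distrib mult.assoc)
  finally show "(\<Sum>p\<in>s - {j}. S i p * (M p q - M p j * M j q / M j j)) = (if i = q then 1 else 0)"
    using inv i q j unfolding inverse_on_def by auto
qed

text \<open>Induction by bordering: the inverse on \<open>s\<close> is padded with zeros at
  \<open>j\<close> and corrected by a rank-one matrix built from the Schur complement.\<close>

lemma pos_def_on_imp_inverse_on:
  assumes "finite s" "pos_def_on s S"
  shows "\<exists>M. inverse_on s S M"
  using assms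
proof (induction s rule: finite_induct)
  case empty
  then show ?case by (simp add: inverse_on_def)
next
  case (insert j s)
  have "pos_def_on s S"
    using pos_def_on_mono[OF insert.prems] insert.hyps by blast
  then obtain N where N: "inverse_on s S N" using insert.IH by blast
  \<comment> \<open>The choice of \<open>u\<close> makes \<open>S u\<close> vanish on
    \<open>s\<close>. Since \<open>u j\<close> is -1, entry \<open>j\<close> of \<open>S u\<close>
    is then \<open>- e\<close>, where \<open>e\<close> is the Schur complement of \<open>S\<close>
    on \<open>s\<close>.\<close>
  define u where "u p = (if p = j then - 1 else \<Sum>q\<in>s. N p q * S q j)" for p
  define N' where "N' p q = (if p = j \<or> q = j then 0 else N p q)" for p q
  define e where "e = bform (insert j s) S u u"
  have "e > 0" using insert.prems unfolding e_def pos_def_on_def u_def by auto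
  have uj: "u j = -1" by (simp add: u_def)
  have nj: "p \<noteq> j" if "p \<in> s" for p using that insert.hyps by blast
  have sym: "S p q = S q p" if "p \<in> insert j s" "q \<in> insert j s" for p q
    using insert.prems that unfolding pos_def_on_def by blast
  have Nsym: "N p q = N q p" if "p \<in> s" "q \<in> s" for p q
    using inverse_on_commute[OF insert.hyps(1) \<open>pos_def_on s S\<close> N that] .
  have Su: "(\<Sum>p\<in>insert j s. S i p * u p) = 0" if i: "i \<in> s" for i
  proof -
    have "(\<Sum>p\<in>s. S i p * u p) = (\<Sum>p\<in>s. \<Sum>q\<in>s. S i p * N p q * S q j)"
      using nj by (intro sum.cong refl) (simp add: u_def sum_distrib_left mult.assoc)
    also have "\<dots> = (\<Sum>q\<in>s. (\<Sum>p\<in>s. S i p * N p q) * S q j)"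
      by (subst sum.swap) (simp add: sum_distrib_right)
    also have "\<dots> = (\<Sum>q\<in>s. if i = q then S q j else 0)"
      using N i unfolding inverse_on_def by (intro sum.cong refl) simp
    finally show ?thesis using insert.hyps i uj by simp
  qed
  have Suj: "(\<Sum>p\<in>insert j s. S j p * u p) = - e"
  proof -
    have "e = (\<Sum>i\<in>insert j s. u i * (\<Sum>p\<in>insert j s. S i p * u p))"
      unfolding e_def bform_row ..
    also have "\<dots> = u j * (\<Sum>p\<in>insert j s. S j p * u p)
        + (\<Sum>i\<in>s. u i * (\<Sum>p\<in>insert j s. S i p * u p))"
      using insert.hyps by (rule sum.insert)
    also have "(\<Sum>i\<in>s. u i * (\<Sum>p\<in>insert j s. S i p * u p)) = 0"
      using Su by (intro sum.neutral) simp
    finally show ?thesis using uj by simp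
  qed
  have "inverse_on (insert j s) S (\<lambda>p q. N' p q + u p * u q / e)"
    unfolding inverse_on_def
  proof (intro ballI)
    fix i q assume i: "i \<in> insert j s" and q: "q \<in> insert j s"
    have "(\<Sum>p\<in>insert j s. S i p * (N' p q + u p * u q / e))
        = (\<Sum>p\<in>insert j s. S i p * N' p q) + (\<Sum>p\<in>insert j s. S i p * u p) * (u q / e)"
      by (simp add: distrib_left sum.distrib sum_distrib_right sum_divide_distrib mult.assoc
          del: sum.insert)
    also have "(\<Sum>p\<in>insert j s. S i p * N' p q) = (if q = j then 0 else \<Sum>p\<in>s. S i p * N p q)"
      using insert.hyps nj by (auto simp: N'_def intro!: sum.cong)
    also have "\<dots> = (if q = j then 0 else if i = j then u q else if i = q then 1 else 0)"
    proof -
      have "(\<Sum>p\<in>s. S j p * N p q) = u q" if "q \<in> s"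
        using nj[OF that] that by (auto simp: u_def sym Nsym mult.commute intro!: sum.cong)
      then show ?thesis using i q N unfolding inverse_on_def by auto
    qed
    finally show "(\<Sum>p\<in>insert j s. S i p * (N' p q + u p * u q / e)) = (if i = q then 1 else 0)"
      using i q Su Suj \<open>e > 0\<close> uj by (cases "i = j") auto
  qed
  then show ?case by blast
qed

section \<open>The barrier argument\<close>

text \<open>Cauchy-Schwarz against column \<open>i\<close> of \<open>N\<close> bounds each
  \<open>x i\<close>. In spectral terms, the least eigenvalue of \<open>S\<close> is at least the
  reciprocal of the trace of its inverse.\<close>

lemma sum_squares_le_trace_bform:
  assumes fin: "finite s" and S: "pos_def_on s S" and N: "inverse_on s S N"
  shows "(\<Sum>i\<in>s. (x i)\<^sup>2) \<le> (\<Sum>i\<in>s. N i i) * bform s S x x"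
proof -
  have "(x i)\<^sup>2 \<le> N i i * bform s S x x" if "i \<in> s" for i
    using bform_Cauchy_Schwarz[OF S, of x "\<lambda>p. N p i"] bform_inverse_on[OF fin N that]
    by (simp add: mult.commute)
  then show ?thesis
    unfolding sum_distrib_right by (rule sum_mono)
qed

text \<open>One round of the argument. The bound \<open>T\<close> is the same before and after, so
  rounds can be iterated with a constant shift.\<close>

lemma barrier_step:
  assumes fin: "finite s" and ne: "s \<noteq> {}" and S: "pos_def_on s S" and N: "inverse_on s S N"
    and T: "(\<Sum>i\<in>s. N i i) \<le> T"
  shows "\<exists>j\<in>s. \<exists>M. pos_def_on (s - {j}) (shift S (1 / (2 * T))) \<and>
    inverse_on (s - {j}) (shift S (1 / (2 * T))) M \<and> (\<Sum>i\<in>s - {j}. M i i) \<le> T"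
proof -
  define d where "d = 1 / (2 * T)"
  let ?S = "shift S d"
  have "(\<Sum>i\<in>s. N i i) > 0"
    using fin ne inverse_on_diag_pos[OF fin S N] by (intro sum_pos) auto
  then have "T > 0" using T by simp
  then have d: "d > 0" "d * T = 1 / 2" by (simp_all add: d_def)
  \<comment> \<open>The form dominates \<open>1 / T\<close> times the sum of squares, and the shift
    is half of that, so at least half of the form survives.\<close>
  have half: "bform s S x x \<le> 2 * bform s ?S x x" for x
  proof -
    have "(\<Sum>i\<in>s. (x i)\<^sup>2) \<le> T * bform s S x x"
      using sum_squares_le_trace_bform[OF fin S N, of x] T bform_nonneg[OF S, of x]
      by (meson mult_right_mono order_trans)
    then have "d * (\<Sum>i\<in>s. x i * x i) \<le> d * (T * bform s S x x)"
      using d by (intro mult_left_mono) (auto simp: power2_eq_square)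
    also have "\<dots> = bform s S x x / 2" using d by (simp flip: mult.assoc)
    finally show ?thesis by (simp add: bform_shift[OF fin])
  qed
  have S': "pos_def_on s ?S"
    unfolding pos_def_on_def
  proof (intro conjI allI impI)
    show "\<forall>i\<in>s. \<forall>j\<in>s. ?S i j = ?S j i"
      using S unfolding pos_def_on_def shift_def by auto
  next
    fix x :: "'a \<Rightarrow> real" assume "\<exists>i\<in>s. x i \<noteq> 0"
    then have "bform s S x x > 0" using S unfolding pos_def_on_def by blast
    then show "bform s ?S x x > 0" using half[of x] by linarith
  qed
  obtain M where M: "inverse_on s ?S M"
    using pos_def_on_imp_inverse_on[OF fin S'] by blast
  define V where "V j = (\<Sum>p\<in>s. (M p j)\<^sup>2)" for j
  have Mpos: "M j j > 0" if "j \<in> s" for j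
    using inverse_on_diag_pos[OF fin S' M that] .
  \<comment> \<open>Entry \<open>M j j\<close> is the \<open>S\<close>-product of column
    \<open>j\<close> of \<open>M\<close> with column \<open>j\<close> of \<open>N\<close>;
    Cauchy-Schwarz and \<open>half\<close> then compare the two diagonals.\<close>
  have diag_le: "M j j \<le> 2 * N j j" if j: "j \<in> s" for j
  proof -
    let ?v = "\<lambda>p. M p j" and ?w = "\<lambda>p. N p j"
    have "(M j j)\<^sup>2 = (bform s S ?v ?w)\<^sup>2"
      by (simp add: bform_inverse_on[OF fin N j])
    also have "\<dots> \<le> bform s S ?v ?v * bform s S ?w ?w"
      by (rule bform_Cauchy_Schwarz[OF S])
    also have "\<dots> \<le> 2 * bform s ?S ?v ?v * bform s S ?w ?w"
      by (intro mult_right_mono half bform_nonneg[OF S])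
    also have "\<dots> = 2 * M j j * N j j"
      by (simp add: bform_inverse_on[OF fin N j] bform_inverse_on[OF fin M j])
    finally show ?thesis using Mpos[OF j] by (simp add: power2_eq_square)
  qed
  \<comment> \<open>The difference \<open>z\<close> of the two columns satisfies
    \<open>S z = d v\<close> on \<open>s\<close>, where \<open>v\<close> is column \<open>j\<close>
    of \<open>M\<close>. Hence nonnegativity of the form at \<open>z\<close> gives the bound;
    \<open>V j\<close> is the diagonal entry of the square of \<open>M\<close>.\<close>
  have increase: "M j j - N j j \<le> d * V j" if j: "j \<in> s" for j
  proof -
    let ?v = "\<lambda>p. M p j" and ?w = "\<lambda>p. N p j"
    have *: "bform s S z ?v - d * (\<Sum>i\<in>s. z i * ?v i) = z j" for z
      using bform_inverse_on[OF fin M j, of z] by (simp add: bform_shift[OF fin])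
    have **: "bform s S z ?w = z j" for z
      using bform_inverse_on[OF fin N j, of z] .
    let ?z = "\<lambda>i. ?v i - ?w i"
    have "0 \<le> bform s S ?z ?z" by (rule bform_nonneg[OF S])
    also have "\<dots> = d * (\<Sum>i\<in>s. ?z i * ?v i)"
      using *[of ?z] **[of ?z] bform_diff_right[of s S ?z ?v ?w] by simp
    also have "\<dots> = d * V j - d * (\<Sum>i\<in>s. ?w i * ?v i)"
      by (simp add: V_def left_diff_distrib sum_subtractf right_diff_distrib power2_eq_square)
    also have "d * (\<Sum>i\<in>s. ?w i * ?v i) = M j j - N j j"
      using *[of ?w] **[of ?v] bform_commute[OF S, of ?v ?w] by simp
    finally show ?thesis by simp
  qed
  have trM: "(\<Sum>j\<in>s. M j j) \<le> 2 * T"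
    using sum_mono[of s "\<lambda>j. M j j" "\<lambda>j. 2 * N j j", OF diag_le] T
    by (simp flip: sum_distrib_left)
  have "V j > 0" if "j \<in> s" for j
    unfolding V_def using fin that Mpos[OF that]
    by (intro sum_pos2[of s j]) auto
  then have Vpos: "(\<Sum>j\<in>s. V j) > 0" using fin ne by (intro sum_pos) auto
  \<comment> \<open>Averaging: \<open>d\<close> times the trace of \<open>M\<close> is at most 1, so
    if the inequality failed for every \<open>j\<close>, summation would make the total of
    \<open>V\<close> smaller than itself.\<close>
  have "\<exists>j\<in>s. d * (\<Sum>j\<in>s. V j) * M j j \<le> V j"
  proof (rule ccontr)
    assume "\<not> ?thesis"
    then have "(\<Sum>j\<in>s. V j) < (\<Sum>j\<in>s. d * (\<Sum>j\<in>s. V j) * M j j)"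
      using fin ne by (intro sum_strict_mono) (auto simp: not_le)
    also have "\<dots> = d * (\<Sum>j\<in>s. V j) * (\<Sum>j\<in>s. M j j)" by (simp flip: sum_distrib_left)
    also have "\<dots> \<le> d * (\<Sum>j\<in>s. V j) * (2 * T)"
      using trM d Vpos by (intro mult_left_mono) auto
    also have "\<dots> = (\<Sum>j\<in>s. V j)" using \<open>T > 0\<close> by (simp add: d_def)
    finally show False by simp
  qed
  then obtain j where j: "j \<in> s" and gain: "d * (\<Sum>j\<in>s. V j) * M j j \<le> V j" by blast
  \<comment> \<open>Deleting \<open>j\<close> lowers the trace by \<open>V j / M j j\<close>, and
    the choice of \<open>j\<close> makes this at least the total increase caused by the
    shift.\<close>
  let ?M = "\<lambda>p q. M p q - M p j * M j q / M j j"
  have "(\<Sum>i\<in>s - {j}. ?M i i) = (\<Sum>i\<in>s. ?M i i)"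
    using fin Mpos[OF j] by (intro sum.mono_neutral_left) auto
  also have "\<dots> = (\<Sum>i\<in>s. M i i) - V j / M j j"
    by (simp add: sum_subtractf V_def sum_divide_distrib power2_eq_square
        inverse_on_commute[OF fin S' M j])
  also have "\<dots> \<le> (\<Sum>i\<in>s. M i i) - d * (\<Sum>j\<in>s. V j)"
    using gain Mpos[OF j] by (simp add: pos_le_divide_eq)
  also have "\<dots> \<le> (\<Sum>i\<in>s. N i i)"
    using sum_mono[of s "\<lambda>j. M j j - N j j" "\<lambda>j. d * V j", OF increase]
    by (simp add: sum_subtractf sum_distrib_left)
  also have "\<dots> \<le> T" by (rule T)
  finally have "(\<Sum>i\<in>s - {j}. ?M i i) \<le> T" .
  moreover have "inverse_on (s - {j}) ?S ?M"
    using inverse_on_delete[OF fin j M] Mpos[OF j] by simp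
  moreover have "pos_def_on (s - {j}) ?S"
    by (rule pos_def_on_mono[OF S' _ fin]) blast
  ultimately show ?thesis using j unfolding d_def by blast
qed

lemma exists_well_conditioned_subset:
  assumes "finite s" "pos_def_on s S" "inverse_on s S N" "(\<Sum>i\<in>s. N i i) \<le> T" "l \<le> card s"
  shows "\<exists>t\<subseteq>s. card t = card s - l \<and> pos_def_on t (shift S (real l / (2 * T)))"
proof -
  \<comment> \<open>The induction also carries an inverse with trace at most \<open>T\<close>, since
    the next round starts from it.\<close>
  have "\<exists>t\<subseteq>s. \<exists>M. card t = card s - l \<and> pos_def_on t (shift S (real l / (2 * T))) \<and>
      inverse_on t (shift S (real l / (2 * T))) M \<and> (\<Sum>i\<in>t. M i i) \<le> T"
    using assms(5)
  proof (induction l)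
    case 0
    have "shift S 0 = S" by (intro ext) (simp add: shift_def)
    then show ?case using assms by auto
  next
    case (Suc l)
    let ?S = "shift S (real l / (2 * T))"
    from Suc obtain t M where t: "t \<subseteq> s" "card t = card s - l" and S: "pos_def_on t ?S"
      and M: "inverse_on t ?S M" "(\<Sum>i\<in>t. M i i) \<le> T"
      by auto
    have fin: "finite t" using t assms finite_subset by blast
    have ne: "t \<noteq> {}" using t Suc.prems by auto
    have eq: "shift ?S (1 / (2 * T)) = shift S (real (Suc l) / (2 * T))"
      by (simp add: shift_shift add_divide_distrib add.commute)
    obtain j M' where "j \<in> t" and
      "pos_def_on (t - {j}) (shift S (real (Suc l) / (2 * T)))"
      "inverse_on (t - {j}) (shift S (real (Suc l) / (2 * T))) M'" "(\<Sum>i\<in>t - {j}. M' i i) \<le> T"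
      using barrier_step[OF fin ne S M] unfolding eq by blast
    moreover have "t - {j} \<subseteq> s" "card (t - {j}) = card s - Suc l"
      using t fin \<open>j \<in> t\<close> by auto
    ultimately show ?case by blast
  qed
  then show ?thesis by blast
qed


section \<open>The Gram matrix of the columns\<close>

lemma restr_op_index:
  assumes "A \<in> carrier_mat n m" "s \<subseteq> {0..<m}" "t < n"
  shows "restr_op A s a $ t = (\<Sum>i\<in>s. a i * A $$ (t, i))"
proof -
  have "restr_op A s a $ t = (\<Sum>i\<in>{0..<m}. A $$ (t, i) * (if i \<in> s then a i else 0))"
    using assms unfolding restr_op_def coord_incl_def by (simp add: scalar_prod_def)
  also have "\<dots> = (\<Sum>i\<in>s. A $$ (t, i) * (if i \<in> s then a i else 0))"
    using assms by (intro sum.mono_neutral_right) auto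
  also have "\<dots> = (\<Sum>i\<in>s. a i * A $$ (t, i))"
    by (intro sum.cong refl) simp
  finally show ?thesis .
qed

lemma restr_op_carrier [simp]:
  assumes "A \<in> carrier_mat n m"
  shows "restr_op A s a \<in> carrier_vec n"
  using assms unfolding restr_op_def coord_incl_def by (intro mult_mat_vec_carrier[of _ n m]) auto

lemma scalar_prod_restr_op:
  assumes "A \<in> carrier_mat n m" "s \<subseteq> {0..<m}" "x \<in> carrier_vec n"
  shows "x \<bullet> restr_op A s a = (\<Sum>i\<in>s. a i * (x \<bullet> col A i))"
proof -
  have "x \<bullet> restr_op A s a = (\<Sum>t\<in>{0..<n}. \<Sum>i\<in>s. a i * (x $ t * A $$ (t, i)))"
    using assms unfolding scalar_prod_def carrier_vecD[OF restr_op_carrier[OF assms(1), of s a]]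
    by (auto simp: restr_op_index[OF assms(1,2)] sum_distrib_left mult_ac intro!: sum.cong)
  also have "\<dots> = (\<Sum>i\<in>s. \<Sum>t\<in>{0..<n}. a i * (x $ t * A $$ (t, i)))"
    by (rule sum.swap)
  also have "\<dots> = (\<Sum>i\<in>s. a i * (x \<bullet> col A i))"
    using assms unfolding scalar_prod_def
    by (intro sum.cong refl) (auto simp: sum_distrib_left intro!: sum.cong)
  finally show ?thesis .
qed

definition gram :: "real mat \<Rightarrow> nat \<Rightarrow> nat \<Rightarrow> real"
  where "gram A i j = col A i \<bullet> col A j"

lemma scalar_prod_col_restr_op:
  assumes "A \<in> carrier_mat n m" "s \<subseteq> {0..<m}" "i < m"
  shows "col A i \<bullet> restr_op A s a = (\<Sum>p\<in>s. gram A i p * a p)"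
  using scalar_prod_restr_op[OF assms(1,2), of "col A i" a] assms
  by (simp add: gram_def mult.commute)

lemma restr_op_scalar_prod_restr_op:
  assumes "A \<in> carrier_mat n m" "s \<subseteq> {0..<m}"
  shows "restr_op A s a \<bullet> restr_op A s b = bform s (gram A) a b"
proof -
  have "restr_op A s a \<bullet> restr_op A s b = restr_op A s b \<bullet> restr_op A s a"
    using assms by (intro comm_scalar_prod[of _ n]) auto
  also have "\<dots> = (\<Sum>i\<in>s. a i * (restr_op A s b \<bullet> col A i))"
    using assms by (intro scalar_prod_restr_op) auto
  also have "\<dots> = (\<Sum>i\<in>s. a i * (col A i \<bullet> restr_op A s b))"
    using assms by (intro sum.cong refl arg_cong2[of _ _ _ _ "(*)"] comm_scalar_prod[of _ n]) auto
  also have "\<dots> = bform s (gram A) a b"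
    unfolding bform_row using assms
    by (intro sum.cong refl) (auto simp: scalar_prod_col_restr_op[OF assms])
  finally show ?thesis .
qed

lemma vec_norm2_nonneg [simp]: "vec_norm2 x \<ge> 0"
  by (simp add: vec_norm2_def)

lemma vec_norm2_square: "(vec_norm2 x)\<^sup>2 = x \<bullet> x"
  unfolding vec_norm2_def L2_set_def scalar_prod_def
  by (simp add: sum_nonneg power2_eq_square)

lemma scalar_prod_self_pos:
  fixes x :: "real vec"
  assumes "x \<in> carrier_vec n" "x \<noteq> 0\<^sub>v n"
  shows "x \<bullet> x > 0"
proof -
  obtain t where "t < n" "x $ t \<noteq> 0"
    using assms by (metis carrier_vecD eq_vecI index_zero_vec)
  then show ?thesis using assms unfolding scalar_prod_def
    by (intro sum_pos2[of _ t]) auto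
qed

lemma pos_def_on_gram:
  assumes A: "A \<in> carrier_mat n m" and w: "w \<subseteq> {0..<m}" and ind: "lin_indpt_family n (col A) w"
  shows "pos_def_on w (gram A)"
  unfolding pos_def_on_def
proof (intro conjI allI impI)
  show "\<forall>i\<in>w. \<forall>j\<in>w. gram A i j = gram A j i"
    using A unfolding gram_def by (auto intro!: comm_scalar_prod[of _ n])
next
  interpret vec_space "TYPE(real)" n .
  fix x :: "nat \<Rightarrow> real" assume "\<exists>i\<in>w. x i \<noteq> 0"
  then obtain i where i: "i \<in> w" "x i \<noteq> 0" by blast
  have inj: "inj_on (col A) w" and indpt: "\<not> lin_dep (col A ` w)"
    using ind unfolding lin_indpt_family_def by auto
  have fin: "finite w" using w finite_subset by blast
  have sub: "col A ` w \<subseteq> carrier_vec n" using A by auto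
  \<comment> \<open>Coefficients in \<open>lincomb\<close> are indexed by vectors, so
    \<open>x\<close> is transported along the injective map \<open>col A\<close>.\<close>
  define a where "a v = x (inv_into w (col A) v)" for v
  have a_i: "a (col A i) \<noteq> 0" using i inj by (simp add: a_def)
  have "lincomb a (col A ` w) = restr_op A w x"
  proof (intro eq_vecI)
    show dim: "dim_vec (lincomb a (col A ` w)) = dim_vec (restr_op A w x)"
      using lincomb_closed[OF sub, of a] restr_op_carrier[OF A, of w x] by auto
    fix t assume "t < dim_vec (restr_op A w x)"
    then have t: "t < n" using restr_op_carrier[OF A, of w x] by simp
    have "lincomb a (col A ` w) $ t = (\<Sum>v\<in>col A ` w. a v * v $ t)"
      using lincomb_index[OF t sub] by simp
    also have "\<dots> = (\<Sum>i\<in>w. x i * col A i $ t)"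
      using inj by (simp add: sum.reindex a_def)
    also have "\<dots> = (\<Sum>i\<in>w. x i * A $$ (t, i))"
      using A w t by (intro sum.cong refl) auto
    finally show "lincomb a (col A ` w) $ t = restr_op A w x $ t"
      using restr_op_index[OF A w t] by simp
  qed
  moreover have "lincomb a (col A ` w) \<noteq> 0\<^sub>v n"
  proof
    assume "lincomb a (col A ` w) = 0\<^sub>v n"
    then have "lin_dep (col A ` w)"
      unfolding lin_dep_def using fin i a_i by (intro exI[of _ "col A ` w"] exI[of _ a]
          exI[of _ "col A i"] conjI) auto
    then show False using indpt by blast
  qed
  ultimately have "restr_op A w x \<noteq> 0\<^sub>v n" by metis
  then show "bform w (gram A) x x > 0"
    using scalar_prod_self_pos[of "restr_op A w x" n] A
    by (simp add: restr_op_scalar_prod_restr_op[OF A w])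
qed

section \<open>Orthogonal projections and the dual basis\<close>

lemma orth_proj_eqI:
  assumes "x \<in> carrier_vec n" and S: "S \<subseteq> carrier_vec n"
    and y: "y \<in> orth_compl n S" "x - y \<in> orth_compl n (orth_compl n S)"
  shows "orth_proj n (orth_compl n S) x = y"
  unfolding orth_proj_def
proof (rule the_equality)
  show "y \<in> orth_compl n S \<and> x - y \<in> orth_compl n (orth_compl n S)" using y by blast
next
  fix z assume z: "z \<in> orth_compl n S \<and> x - z \<in> orth_compl n (orth_compl n S)"
  have car: "y \<in> carrier_vec n" "z \<in> carrier_vec n"
    using y z unfolding vec_module.orthogonal_complement_def by auto
  \<comment> \<open>Writing \<open>z - y\<close> as \<open>(x - y) - (x - z)\<close>, these four
    products show that it is orthogonal to itself.\<close>
  have "(x - y) \<bullet> y = 0" "(x - y) \<bullet> z = 0" "(x - z) \<bullet> y = 0" "(x - z) \<bullet> z = 0"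
    using y z unfolding vec_module.orthogonal_complement_def by auto
  then have "(z - y) \<bullet> (z - y) = 0"
    using car assms(1) by (simp add: minus_scalar_prod_distrib[of _ n]
        scalar_prod_minus_distrib[of _ n])
  then have "z - y = 0\<^sub>v n"
    using scalar_prod_self_pos[of "z - y" n] car by force
  then have "(z - y) $ t = 0" if "t < n" for t using that by simp
  then show "z = y" using car by (intro eq_vecI) auto
qed

text \<open>The columns of the inverse Gram matrix are the coefficients of the dual basis, and the
  projection onto \<^term>\<open>compl_space n A w j\<close> is a multiple of the dual vector.\<close>

lemma norm_orth_proj_compl_space:
  assumes A: "A \<in> carrier_mat n m" and w: "w \<subseteq> {0..<m}" and j: "j \<in> w"
    and G: "pos_def_on w (gram A)" and H: "inverse_on w (gram A) H"
  shows "(1 / vec_norm2 (orth_proj n (compl_space n A w j) (col A j)))\<^sup>2 = H j j"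
proof -
  interpret vec_space "TYPE(real)" n .
  have fin: "finite w" using w finite_subset by blast
  have sub: "col A ` (w - {j}) \<subseteq> carrier_vec n" using A by auto
  have pos: "H j j > 0" using inverse_on_diag_pos[OF fin G H j] .
  \<comment> \<open>The dual vector has squared norm \<open>H j j\<close>; dividing by this number
    gives \<open>col A j\<close> coefficient 1 in \<open>y\<close>.\<close>
  define y where "y = restr_op A w (\<lambda>p. H p j / H j j)"
  have y: "y \<in> carrier_vec n" using A by (simp add: y_def)
  have col_y: "col A i \<bullet> y = (if i = j then 1 / H j j else 0)" if "i \<in> w" for i
  proof -
    have "col A i \<bullet> y = (\<Sum>p\<in>w. gram A i p * H p j) / H j j"
      unfolding y_def using that w
      by (subst scalar_prod_col_restr_op[OF A w]) (auto simp: sum_divide_distrib)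
    then show ?thesis using H that j unfolding inverse_on_def by simp
  qed
  have y_col: "y \<bullet> col A i = (if i = j then 1 / H j j else 0)" if "i \<in> w" for i
    using col_y[OF that] comm_scalar_prod[OF y, of "col A i"] A by auto
  have "y \<in> orth_compl n (col A ` (w - {j}))"
    using y y_col unfolding orthogonal_complement_def by auto
  \<comment> \<open>By this normalization, \<open>col A j - y\<close> is a combination of the other
    columns, so every \<open>z\<close> orthogonal to those is orthogonal to it.\<close>
  moreover have "col A j - y \<in> orth_compl n (orth_compl n (col A ` (w - {j})))"
    unfolding orthogonal_complement_def[of "orthogonal_complement _"]
  proof (intro CollectI conjI ballI)
    show "col A j - y \<in> carrier_vec n" using A y by auto
    fix z assume "z \<in> orth_compl n (col A ` (w - {j}))"
    then have z: "z \<in> carrier_vec n" and orth: "\<And>i. i \<in> w - {j} \<Longrightarrow> z \<bullet> col A i = 0"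
      unfolding orthogonal_complement_def by auto
    have "z \<bullet> y = (\<Sum>i\<in>w. H i j / H j j * (z \<bullet> col A i))"
      unfolding y_def using scalar_prod_restr_op[OF A w z] .
    also have "\<dots> = (\<Sum>i\<in>w. if i = j then z \<bullet> col A j else 0)"
      using orth pos by (intro sum.cong refl) auto
    also have "\<dots> = z \<bullet> col A j" using fin j by simp
    finally have "z \<bullet> (col A j - y) = 0"
      using A y z by (subst scalar_prod_minus_distrib[of _ n]) auto
    then show "(col A j - y) \<bullet> z = 0"
      using A y z comm_scalar_prod[of "col A j - y" n z] by auto
  qed
  ultimately have "orth_proj n (compl_space n A w j) (col A j) = y"
    unfolding compl_space_def in_orthogonal_complement_span[OF sub]
    using A sub by (intro orth_proj_eqI) auto
  moreover have "y \<bullet> y = 1 / H j j"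
  proof -
    have "y \<bullet> y = (\<Sum>i\<in>w. H i j / H j j * (y \<bullet> col A i))"
      using scalar_prod_restr_op[OF A w y, of "\<lambda>p. H p j / H j j"] unfolding y_def .
    also have "\<dots> = (\<Sum>i\<in>w. if i = j then 1 / H j j else 0)"
      using y_col pos by (intro sum.cong refl) auto
    finally show ?thesis using fin j by simp
  qed
  ultimately show ?thesis by (simp add: power_divide vec_norm2_square)
qed

section \<open>The norm of the restricted inverse and the conclusion\<close>

text \<open>A lower bound for the restricted operator forces injectivity, which excludes the
  infinite value, and bounds the inverse on the unit ball of the image.\<close>

lemma restr_inv_norm_le:
  assumes A: "A \<in> carrier_mat n m" and s: "s \<subseteq> {0..<m}" and K: "K \<ge> 0"
    and bound: "\<And>a. L2_set a s \<le> K * vec_norm2 (restr_op A s a)"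
  shows "restr_inv_norm A s \<le> ereal K"
proof -
  have fin: "finite s" using s finite_subset by blast
  have inj: "inj_on (restr_op A s) (coord_space s)"
  proof (rule inj_onI)
    fix a b assume a: "a \<in> coord_space s" and b: "b \<in> coord_space s"
      and eq: "restr_op A s a = restr_op A s b"
    have "restr_op A s (\<lambda>i. a i - b i) = 0\<^sub>v n"
    proof (intro eq_vecI)
      fix t assume "t < dim_vec (0\<^sub>v n :: real vec)"
      then have t: "t < n" by simp
      have "restr_op A s (\<lambda>i. a i - b i) $ t = restr_op A s a $ t - restr_op A s b $ t"
        by (simp add: restr_op_index[OF A s t] left_diff_distrib sum_subtractf)
      then show "restr_op A s (\<lambda>i. a i - b i) $ t = 0\<^sub>v n $ t" using eq t by simp
    qed (use restr_op_carrier[OF A, of s] in simp)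
    then have "vec_norm2 (restr_op A s (\<lambda>i. a i - b i)) = 0"
      by (simp add: vec_norm2_def L2_set_def)
    then have "L2_set (\<lambda>i. a i - b i) s = 0"
      using bound[of "\<lambda>i. a i - b i"] L2_set_nonneg[of "\<lambda>i. a i - b i" s] by simp
    then have "\<forall>i\<in>s. a i - b i = 0" using fin by (simp add: L2_set_eq_0_iff)
    \<comment> \<open>Members of \<open>coord_space s\<close> are \<open>undefined\<close> outside
      \<open>s\<close>, so agreement on \<open>s\<close> is equality.\<close>
    then show "a = b" using a b by (intro PiE_ext[of a s _ b]) auto
  qed
  have "op_norm (restr_op A s ` coord_space s) vec_norm2 (\<lambda>a. L2_set a s)
      (inv_into (coord_space s) (restr_op A s)) \<le> ereal K"
    unfolding op_norm_def
  proof (rule SUP_least)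
    fix x assume "x \<in> {x \<in> restr_op A s ` coord_space s. vec_norm2 x \<le> 1}"
    then obtain a where a: "a \<in> coord_space s" "x = restr_op A s a" "vec_norm2 x \<le> 1" by blast
    have "L2_set a s \<le> K * 1"
      using bound[of a] a K by (metis mult_left_mono order_trans)
    then show "ereal (L2_set (inv_into (coord_space s) (restr_op A s) x) s) \<le> ereal K"
      using a inj by simp
  qed
  then show ?thesis using inj by (simp add: restr_inv_norm_def)
qed

lemma restricted_invertibility:
  assumes A: "A \<in> carrier_mat n m" and w: "w \<subseteq> {0..<m}" and ind: "lin_indpt_family n (col A) w"
    and k: "k < card w"
    and D: "\<And>j. j \<in> w \<Longrightarrow> 1 / vec_norm2 (orth_proj n (compl_space n A w j) (col A j)) \<le> D"
  shows "\<exists>s\<subseteq>w. card s = k \<and> restr_inv_norm A s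
    \<le> ereal (sqrt 2 * (sqrt (real (card w)) / sqrt (real (card w) - real k)) * D)"
proof -
  define r where "r = card w"
  define T where "T = real r * D\<^sup>2"
  \<comment> \<open>This is the total shift after \<open>r - k\<close> rounds; \<open>K\<close> is
    the reciprocal of its square root.\<close>
  define c where "c = real (r - k) / (2 * T)"
  define K where "K = sqrt 2 * (sqrt (real r) / sqrt (real r - real k)) * D"
  have fin: "finite w" using w finite_subset by blast
  have G: "pos_def_on w (gram A)" by (rule pos_def_on_gram[OF A w ind])
  obtain H where H: "inverse_on w (gram A) H"
    using pos_def_on_imp_inverse_on[OF fin G] by blast
  have H_le: "H j j \<le> D\<^sup>2" if "j \<in> w" for j
    unfolding norm_orth_proj_compl_space[OF A w that G H, symmetric]
    using D[OF that] by (intro power_mono) auto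
  have trace: "(\<Sum>j\<in>w. H j j) \<le> T"
    using sum_mono[of w "\<lambda>j. H j j" "\<lambda>_. D\<^sup>2", OF H_le] by (simp add: T_def r_def)
  obtain j where j: "j \<in> w" using k by fastforce
  have "D \<ge> 0" using D[OF j] by (rule order_trans[rotated]) simp
  \<comment> \<open>Strict positivity of \<open>D\<close> makes the division by \<open>T\<close> in
    \<open>c\<close> genuine.\<close>
  moreover have "D\<^sup>2 > 0" using H_le[OF j] inverse_on_diag_pos[OF fin G H j] by linarith
  ultimately have Dpos: "D > 0" by (cases "D = 0") auto
  have rk: "k < r" using k by (simp add: r_def)
  obtain s where s: "s \<subseteq> w" "card s = r - (r - k)" and P: "pos_def_on s (shift (gram A) c)"
    using exists_well_conditioned_subset[OF fin G H trace, of "r - k"] by (auto simp: c_def r_def)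
  have sm: "s \<subseteq> {0..<m}" and fs: "finite s" using s w fin finite_subset by auto
  have Kpos: "K > 0" using Dpos rk by (simp add: K_def)
  have K2: "K\<^sup>2 * c = 1"
    using Dpos rk by (simp add: K_def c_def T_def power_mult_distrib power_divide of_nat_diff)
  have "L2_set a s \<le> K * vec_norm2 (restr_op A s a)" for a
  proof -
    \<comment> \<open>Nonnegativity of the shifted Gram form at \<open>a\<close> is exactly this
      lower bound for the restricted operator.\<close>
    have "c * (\<Sum>i\<in>s. (a i)\<^sup>2) \<le> (vec_norm2 (restr_op A s a))\<^sup>2"
      using bform_nonneg[OF P, of a]
      unfolding vec_norm2_square restr_op_scalar_prod_restr_op[OF A sm]
      by (simp add: bform_shift[OF fs] power2_eq_square)
    then have "K\<^sup>2 * (c * (\<Sum>i\<in>s. (a i)\<^sup>2)) \<le> K\<^sup>2 * (vec_norm2 (restr_op A s a))\<^sup>2"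
      by (intro mult_left_mono) auto
    then have "(\<Sum>i\<in>s. (a i)\<^sup>2) \<le> (K * vec_norm2 (restr_op A s a))\<^sup>2"
      unfolding power_mult_distrib mult.assoc[symmetric] K2 mult_1_left .
    moreover have "(L2_set a s)\<^sup>2 = (\<Sum>i\<in>s. (a i)\<^sup>2)"
      by (simp add: L2_set_def sum_nonneg)
    ultimately have "(L2_set a s)\<^sup>2 \<le> (K * vec_norm2 (restr_op A s a))\<^sup>2"
      by (rule ord_eq_le_trans[rotated])
    then show ?thesis
      by (rule power2_le_imp_le) (use Kpos in simp)
  qed
  then have "restr_inv_norm A s \<le> ereal K"
    using restr_inv_norm_le[OF A sm] Kpos by simp
  moreover have "card s = k" using s rk by simp
  ultimately show ?thesis using s(1) unfolding K_def r_def by blast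
qed

theorem theorem9:
  shows "\<exists>C::real. C > 0 \<and>
    (\<forall>(k::nat) (m::nat) (n::nat) (A::real mat) (w::nat set).
       k \<ge> 1 \<longrightarrow> m \<ge> 1 \<longrightarrow> n \<ge> 1 \<longrightarrow>
       A \<in> carrier_mat n m \<longrightarrow>
       real_rank n A > k \<longrightarrow>
       w \<subseteq> {0..<m} \<longrightarrow>
       card w = real_rank n A \<longrightarrow>
       lin_indpt_family n (col A) w \<longrightarrow>
       (\<exists>s. s \<subseteq> w \<and> card s = k \<and>
          restr_inv_norm A s \<le>
            ereal (C * (sqrt (real (real_rank n A)) / sqrt (real (real_rank n A) - real k)) *
              (MAX j\<in>w. 1 / vec_norm2 (orth_proj n (compl_space n A w j) (col A j))))))"
proof (intro exI[of _ "sqrt 2"] conjI allI impI)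
  fix k m n :: nat and A :: "real mat" and w :: "nat set"
  assume A: "A \<in> carrier_mat n m" and k: "real_rank n A > k" and w: "w \<subseteq> {0..<m}"
    and card: "card w = real_rank n A" and ind: "lin_indpt_family n (col A) w"
  \<comment> \<open>Finiteness places every quotient below the maximum, which can then serve as
    \<open>D\<close>.\<close>
  have "finite w" using w finite_subset by blast
  then show "\<exists>s. s \<subseteq> w \<and> card s = k \<and> restr_inv_norm A s \<le>
    ereal (sqrt 2 * (sqrt (real (real_rank n A)) / sqrt (real (real_rank n A) - real k)) *
      (MAX j\<in>w. 1 / vec_norm2 (orth_proj n (compl_space n A w j) (col A j))))"
    using restricted_invertibility[OF A w ind, of k] k unfolding card[symmetric] by simp
qed simp

end
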